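(* Let $1<s<p<\infty$, $n\ge2$, let $\Omega\subseteq\mathbb{R}^n$ be a domain, and let $a=(a_1,\dots,a_n)$ be a weight vector as in the context. Then there exists a positive constant $c(p,s)$, depending only on $p$ and $s$, such that for almost all $x\in\Omega$ and all $\xi,\eta\in\mathbb{R}^n$, $$|\xi+\eta|_{s,a}^{p}-|\xi|_{s,a}^{p}-p|\xi|_{s,a}^{p-s}\sum_{i=1}^{n}a_{i}(x)|\xi_{i}|^{s-2}\xi_{i}\eta_{i}\ \ge\ c(p,s)\,|\xi|_{s,a}^{p-s}\sum_{i=1}^{n}|\eta'_{i}|^{2}\left(|\eta'_{i}|+|\xi'_{i}|\right)^{s-2}.$$
   Context: The functions $a_1,\dots,a_n:\Omega\to(0,\infty)$ are Lebesgue measurable and locally equivalent to $1$: for every domain $\omega$ whose closure is a compact subset of $\Omega$ there are constants $0<c_\omega\le C_\omega<\infty$ with $c_\omega\le a_i\le C_\omega$ a.e. in $\omega$. For almost all $x\in\Omega$ and $\xi\in\mathbb{R}^n$, $|\xi|_{s,a}=\left(\sum_{i=1}^n a_i(x)|\xi_i|^s\right)^{1/s}$, and $\xi_i'=a_i(x)^{1/s}\xi_i$ (similarly $\eta_i'$). Conventions: $|t|^{s-2}t=0$ for $t=0$, and $t^2(t+\tau)^{s-2}=0$ when $t=\tau=0$. (The left-hand side is the Bregman distance of $|\cdot|_{s,a}^p$ at $(\xi+\eta,\xi)$.) *)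

theory Defs
  imports "HOL-Analysis.Analysis"
begin

text \<open>
  The constant in the theorem must not depend on the dimension, so the dimension n has to be
  quantified inside the statement and cannot be a type. The space R^n is therefore
  the set of extensional functions on \<open>{1..n}\<close>; this set is both the carrier of the product
  topology and the space of the product measure below.
\<close>

abbreviation Rn :: "nat \<Rightarrow> (nat \<Rightarrow> real) set" where
  "Rn n \<equiv> {1..n} \<rightarrow>\<^sub>E UNIV"

definition Rn_top :: "nat \<Rightarrow> (nat \<Rightarrow> real) topology" where
  "Rn_top n = product_topology (\<lambda>_. euclideanreal) {1..n}"

definition lebesgue_n :: "nat \<Rightarrow> (nat \<Rightarrow> real) measure" where
  "lebesgue_n n = completion (Pi\<^sub>M {1..n} (\<lambda>_. lborel))"

lemma topspace_Rn_top: "topspace (Rn_top n) = Rn n"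
  by (simp add: Rn_top_def)

lemma space_lebesgue_n: "space (lebesgue_n n) = Rn n"
  by (simp add: lebesgue_n_def space_PiM)

definition is_domain :: "nat \<Rightarrow> (nat \<Rightarrow> real) set \<Rightarrow> bool" where
  "is_domain n \<Omega> \<longleftrightarrow> \<Omega> \<noteq> {} \<and> openin (Rn_top n) \<Omega> \<and> connectedin (Rn_top n) \<Omega>"

definition compactly_contained :: "nat \<Rightarrow> (nat \<Rightarrow> real) set \<Rightarrow> (nat \<Rightarrow> real) set \<Rightarrow> bool" where
  "compactly_contained n \<omega> \<Omega> \<longleftrightarrow>
     compactin (Rn_top n) (Rn_top n closure_of \<omega>) \<and> Rn_top n closure_of \<omega> \<subseteq> \<Omega>"

definition weight_vector ::
    "nat \<Rightarrow> (nat \<Rightarrow> real) set \<Rightarrow> (nat \<Rightarrow> (nat \<Rightarrow> real) \<Rightarrow> real) \<Rightarrow> bool" where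
  "weight_vector n \<Omega> a \<longleftrightarrow>
     (\<forall>i\<in>{1..n}. a i \<in> borel_measurable (restrict_space (lebesgue_n n) \<Omega>) \<and> (\<forall>x\<in>\<Omega>. 0 < a i x)) \<and>
     (\<forall>\<omega>. is_domain n \<omega> \<and> compactly_contained n \<omega> \<Omega> \<longrightarrow>
        (\<exists>c C. 0 < c \<and> c \<le> C \<and>
           (\<forall>i\<in>{1..n}. AE x\<in>\<omega> in lebesgue_n n. c \<le> a i x \<and> a i x \<le> C)))"

definition wnorm ::
    "nat \<Rightarrow> real \<Rightarrow> (nat \<Rightarrow> (nat \<Rightarrow> real) \<Rightarrow> real) \<Rightarrow> (nat \<Rightarrow> real) \<Rightarrow> (nat \<Rightarrow> real) \<Rightarrow> real" where
  "wnorm n s a x \<xi> = (\<Sum>i=1..n. a i x * \<bar>\<xi> i\<bar> powr s) powr (1 / s)"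

definition scaled ::
    "real \<Rightarrow> (nat \<Rightarrow> (nat \<Rightarrow> real) \<Rightarrow> real) \<Rightarrow> (nat \<Rightarrow> real) \<Rightarrow> (nat \<Rightarrow> real) \<Rightarrow> nat \<Rightarrow> real" where
  "scaled s a x \<xi> i = a i x powr (1 / s) * \<xi> i"

text \<open>
  Powers with exponent \<open>s - 2\<close>, possibly negative or zero, are only ever multiplied by a factor
  that vanishes when their base does. So \<open>0 powr r = 0\<close> yields the conventions
  \<open>\<bar>t\<bar> powr (s - 2) * t = 0\<close> for \<open>t = 0\<close> and \<open>t\<^sup>2 * (t + \<tau>) powr (s - 2) = 0\<close> for \<open>t = \<tau> = 0\<close>.
\<close>

end

theory Submission
  imports Defs "HOL-Real_Asymp.Real_Asymp"
begin

text \<open>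
  Set \<open>q = p / s > 1\<close>, \<open>u = \<xi>'\<close>, \<open>v = \<eta>'\<close>, \<open>A = \<Sum>|u\<^sub>i|\<^sup>s\<close> and \<open>B = \<Sum>|u\<^sub>i + v\<^sub>i|\<^sup>s\<close>. The tangent line of the convex
  function \<open>t \<mapsto> t\<^sup>q\<close> at \<open>A\<close> reduces the claim to a lower bound for
  \<open>B - A - s \<Sum>|u\<^sub>i|\<^bsup>s-2\<^esup>u\<^sub>iv\<^sub>i\<close>, which is proved coordinatewise. By homogeneity the coordinate
  inequality amounts to a positive lower bound for
  \<open>(|1 + t|\<^sup>s - 1 - s t) / (t\<^sup>2 (1 + |t|)\<^bsup>s-2\<^esup>)\<close>. This quotient is positive by strict convexity
  and has positive limits at \<open>0\<close> and at infinity, so compactness gives the bound.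
\<close>

text \<open>By the mean value theorem the secant slope between \<open>x\<close> and \<open>y\<close>
  is \<open>s * z powr (s - 1)\<close> at an intermediate \<open>z\<close>, and this slope is
  strictly increasing in \<open>z\<close>. It serves twice: with exponent \<open>s\<close> at the
  point 1, and with exponent \<open>p / s\<close> for the outer power.\<close>

lemma powr_gt_tangent:
  fixes x y s :: real
  assumes "1 < s" "0 \<le> x" "0 < y" "x \<noteq> y"
  shows "y powr s + s * y powr (s - 1) * (x - y) < x powr s"
proof -
  have deriv: "((\<lambda>z. z powr s) has_real_derivative s * z powr (s - 1)) (at z)" if "0 < z" for z :: real
    using that by (auto intro!: derivative_eq_intros)
  consider "x = 0" | "0 < x" "x < y" | "y < x"
    using assms by linarith
  then show ?thesis
  proof cases
    \<comment> \<open>The derivative is only available for \<open>z > 0\<close>, so the endpoint 0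
      is computed directly: the left-hand side is \<open>(1 - s) * y powr s < 0\<close>.\<close>
    case 1
    then show ?thesis
      using assms by (simp add: powr_diff)
  next
    case 2
    then obtain z where z: "x < z" "z < y" "y powr s - x powr s = (y - x) * (s * z powr (s - 1))"
      using MVT2[of x y "\<lambda>z. z powr s" "\<lambda>z. s * z powr (s - 1)"] deriv by force
    have "z powr (s - 1) < y powr (s - 1)"
      using z 2 assms by (intro powr_less_mono2) auto
    then have "(y - x) * (s * z powr (s - 1)) < (y - x) * (s * y powr (s - 1))"
      using 2 assms by (intro mult_strict_left_mono) auto
    then show ?thesis
      using z(3) by (simp add: algebra_simps)
  next
    case 3
    then obtain z where z: "y < z" "z < x" "x powr s - y powr s = (x - y) * (s * z powr (s - 1))"
      using MVT2[of y x "\<lambda>z. z powr s" "\<lambda>z. s * z powr (s - 1)"] deriv assms by force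
    have "y powr (s - 1) < z powr (s - 1)"
      using z assms by (intro powr_less_mono2) auto
    then have "(x - y) * (s * y powr (s - 1)) < (x - y) * (s * z powr (s - 1))"
      using 3 assms by (intro mult_strict_left_mono) auto
    then show ?thesis
      using z(3) by (simp add: algebra_simps)
  qed
qed

lemma abs_powr_gt_linear:
  fixes s t :: real
  assumes "1 < s" "t \<noteq> 0"
  shows "1 + s * t < \<bar>1 + t\<bar> powr s"
proof (cases "0 \<le> 1 + t")
  case True
  then show ?thesis
    using powr_gt_tangent[of s "1 + t" 1] assms by simp
next
  case False
  \<comment> \<open>For \<open>t < -1\<close> the line has already fallen below
    \<open>1 - s < 0\<close>, so nonnegativity of the power suffices.\<close>
  then have "s * t \<le> s * (-1)"
    using assms by (intro mult_left_mono) auto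
  then have "1 + s * t < 0"
    using assms by simp
  also have "0 \<le> \<bar>1 + t\<bar> powr s"
    by simp
  finally show ?thesis .
qed

text \<open>The comparison function has the order of the Bregman remainder at both ends: it behaves
  like \<open>t^2\<close> near 0 and like \<open>\<bar>t\<bar> powr s\<close> at infinity. Hence the
  quotient has finite positive limits there.\<close>

lemma bregman_abs_powr_normalized:
  fixes s :: real
  assumes s: "1 < s"
  shows "\<exists>c>0. \<forall>t. c * (t\<^sup>2 * (1 + \<bar>t\<bar>) powr (s - 2)) \<le> \<bar>1 + t\<bar> powr s - 1 - s * t"
proof -
  define g where "g t = (\<bar>1 + t\<bar> powr s - 1 - s * t) / (t\<^sup>2 * (1 + \<bar>t\<bar>) powr (s - 2))" for t :: real
  \<comment> \<open>At 0 the quotient \<open>g\<close> is 0/0; the value inserted is its limit, half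
    the second derivative of \<open>(1 + t) powr s\<close> at 0.\<close>
  define G where "G t = (if t = 0 then s * (s - 1) / 2 else g t)" for t
  have pos: "0 < g t" if "t \<noteq> 0" for t
    unfolding g_def using abs_powr_gt_linear[OF s that] that by (intro divide_pos_pos) auto
  have r: "(g \<longlongrightarrow> s * (s - 1) / 2) (at_right 0)"
    unfolding g_def using s by real_asymp
  have l: "(g \<longlongrightarrow> s * (s - 1) / 2) (at_left 0)"
    unfolding g_def using s by real_asymp
  have t: "(g \<longlongrightarrow> 1) at_top"
    unfolding g_def using s by real_asymp
  have b: "(g \<longlongrightarrow> 1) at_bot"
    unfolding g_def using s by real_asymp
  have g0: "g \<midarrow>0\<rightarrow> G 0"
    using l r by (simp add: G_def filterlim_at_split)
  have "isCont G t" for t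
  proof (cases "t = 0")
    case True
    have "G \<midarrow>0\<rightarrow> G 0"
      using g0 by (rule Lim_transform_eventually) (auto simp: G_def eventually_at_filter)
    then show ?thesis
      using True by (simp add: isCont_def)
  next
    case False
    have "isCont g t"
      unfolding g_def using False s by (intro continuous_intros) auto
    moreover have "\<forall>\<^sub>F x in nhds t. G x = g x"
      using t1_space_nhds[OF False] by eventually_elim (simp add: G_def)
    ultimately show ?thesis
      by (simp add: isCont_cong)
  qed
  then have cont: "continuous_on K G" for K
    by (simp add: continuous_at_imp_continuous_on)
  have "\<forall>\<^sub>F t in at_top. 1/2 < g t" "\<forall>\<^sub>F t in at_bot. 1/2 < g t"
    by (rule order_tendstoD(1)[OF t], simp) (rule order_tendstoD(1)[OF b], simp)
  then obtain M N where M: "\<And>t. M \<le> t \<Longrightarrow> 1/2 < g t" and N: "\<And>t. t \<le> N \<Longrightarrow> 1/2 < g t"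
    by (auto simp: eventually_at_top_linorder eventually_at_bot_linorder)
  \<comment> \<open>Including 0 makes the interval nonempty whatever the signs of \<open>M\<close>
    and \<open>N\<close>; outside it \<open>g\<close> exceeds 1/2.\<close>
  define K where "K = {min N 0..max M 0}"
  have "compact K" "K \<noteq> {}"
    by (auto simp: K_def)
  then obtain t0 where t0: "\<And>t. t \<in> K \<Longrightarrow> G t0 \<le> G t"
    using continuous_attains_inf[OF _ _ cont] by metis
  \<comment> \<open>\<open>G t0\<close> bounds the quotient on \<open>K\<close>, and 1/2 bounds it
    on the tails.\<close>
  define c where "c = min (G t0) (1/2)"
  have "0 < G t0"
    using pos s by (auto simp: G_def)
  then have "0 < c"
    by (simp add: c_def)
  moreover have "c * (t\<^sup>2 * (1 + \<bar>t\<bar>) powr (s - 2)) \<le> \<bar>1 + t\<bar> powr s - 1 - s * t" for t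
  proof (cases "t = 0")
    case False
    have "c \<le> g t"
    proof (cases "t \<in> K")
      case True
      then show ?thesis
        using t0[OF True] False by (auto simp: c_def G_def split: if_splits)
    next
      case False
      then have "1/2 < g t"
        using M[of t] N[of t] by (auto simp: K_def)
      then show ?thesis
        by (simp add: c_def)
    qed
    moreover have "0 < t\<^sup>2 * (1 + \<bar>t\<bar>) powr (s - 2)"
      using False by (intro mult_pos_pos) auto
    ultimately show ?thesis
      by (simp add: g_def pos_le_divide_eq)
  qed simp
  ultimately show ?thesis
    by blast
qed

text \<open>Both sides are homogeneous of degree \<open>s\<close> in \<open>(u, v)\<close>, so for
  \<open>u \<noteq> 0\<close> the factor \<open>\<bar>u\<bar> powr s\<close> splits off and
  \<open>t = v / u\<close> remains.\<close>

lemma bregman_abs_powr: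
  fixes s :: real
  assumes s: "1 < s"
  shows "\<exists>c>0. \<forall>u v. c * (v\<^sup>2 * (\<bar>v\<bar> + \<bar>u\<bar>) powr (s - 2))
    \<le> \<bar>u + v\<bar> powr s - \<bar>u\<bar> powr s - s * (\<bar>u\<bar> powr (s - 2) * u * v)"
proof -
  obtain c where c: "0 < c"
    "\<And>t. c * (t\<^sup>2 * (1 + \<bar>t\<bar>) powr (s - 2)) \<le> \<bar>1 + t\<bar> powr s - 1 - s * t"
    using bregman_abs_powr_normalized[OF s] by blast
  \<comment> \<open>For \<open>u = 0\<close> the claim reads
    \<open>d * \<bar>v\<bar> powr s \<le> \<bar>v\<bar> powr s\<close>, which forces the cap at
    1.\<close>
  define d where "d = min c 1"
  have "d * (v\<^sup>2 * (\<bar>v\<bar> + \<bar>u\<bar>) powr (s - 2))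
    \<le> \<bar>u + v\<bar> powr s - \<bar>u\<bar> powr s - s * (\<bar>u\<bar> powr (s - 2) * u * v)" for u v
  proof (cases "u = 0")
    case True
    have "v\<^sup>2 * \<bar>v\<bar> powr (s - 2) = \<bar>v\<bar> powr s"
      by (cases "v = 0") (simp_all add: powr_diff)
    moreover have "d * \<bar>v\<bar> powr s \<le> 1 * \<bar>v\<bar> powr s"
      by (intro mult_right_mono) (auto simp: d_def)
    ultimately show ?thesis
      using True by simp
  next
    case False
    define t where "t = v / u"
    have v: "v = u * t"
      using False by (simp add: t_def)
    have sq: "\<bar>u\<bar> powr (s - 2) * u\<^sup>2 = \<bar>u\<bar> powr s"
      using False by (simp add: powr_diff)
    have "u + v = u * (1 + t)"
      by (simp add: v algebra_simps)
    then have p1: "\<bar>u + v\<bar> powr s = \<bar>u\<bar> powr s * \<bar>1 + t\<bar> powr s"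
      by (simp add: abs_mult powr_mult)
    have "\<bar>v\<bar> + \<bar>u\<bar> = \<bar>u\<bar> * (1 + \<bar>t\<bar>)"
      by (simp add: v abs_mult algebra_simps)
    then have p2: "v\<^sup>2 * (\<bar>v\<bar> + \<bar>u\<bar>) powr (s - 2) = \<bar>u\<bar> powr s * (t\<^sup>2 * (1 + \<bar>t\<bar>) powr (s - 2))"
      by (simp add: powr_mult v power_mult_distrib flip: sq)
    have p3: "\<bar>u\<bar> powr (s - 2) * u * v = \<bar>u\<bar> powr s * t"
      by (simp add: v power2_eq_square flip: sq)
    have "d * (t\<^sup>2 * (1 + \<bar>t\<bar>) powr (s - 2)) \<le> c * (t\<^sup>2 * (1 + \<bar>t\<bar>) powr (s - 2))"
      by (intro mult_right_mono) (auto simp: d_def)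
    also have "\<dots> \<le> \<bar>1 + t\<bar> powr s - 1 - s * t"
      by (rule c)
    finally have "\<bar>u\<bar> powr s * (d * (t\<^sup>2 * (1 + \<bar>t\<bar>) powr (s - 2)))
        \<le> \<bar>u\<bar> powr s * (\<bar>1 + t\<bar> powr s - 1 - s * t)"
      by (intro mult_left_mono) auto
    then show ?thesis
      unfolding p1 p2 p3 by (simp add: algebra_simps)
  qed
  moreover have "0 < d"
    using c by (simp add: d_def)
  ultimately show ?thesis
    by blast
qed

text \<open>The scalar constant \<open>c\<close> is fixed before the index set \<open>I\<close>, so
  the resulting constant \<open>p / s * c\<close> does not depend on the dimension.\<close>

lemma bregman_lnorm_powr:
  fixes u v :: "'i \<Rightarrow> real" and I :: "'i set"
  assumes s: "1 < s" and p: "s < p"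
    and c: "\<And>u v. c * (v\<^sup>2 * (\<bar>v\<bar> + \<bar>u\<bar>) powr (s - 2))
      \<le> \<bar>u + v\<bar> powr s - \<bar>u\<bar> powr s - s * (\<bar>u\<bar> powr (s - 2) * u * v)"
  defines "A \<equiv> \<Sum>i\<in>I. \<bar>u i\<bar> powr s" and "B \<equiv> \<Sum>i\<in>I. \<bar>u i + v i\<bar> powr s"
  shows "p / s * c * A powr ((p - s) / s) * (\<Sum>i\<in>I. (v i)\<^sup>2 * (\<bar>v i\<bar> + \<bar>u i\<bar>) powr (s - 2))
    \<le> B powr (p / s) - A powr (p / s)
      - p * A powr ((p - s) / s) * (\<Sum>i\<in>I. \<bar>u i\<bar> powr (s - 2) * u i * v i)"
proof -
  define q where "q = p / s"
  define S where "S = (\<Sum>i\<in>I. \<bar>u i\<bar> powr (s - 2) * u i * v i)"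
  define R where "R = (\<Sum>i\<in>I. (v i)\<^sup>2 * (\<bar>v i\<bar> + \<bar>u i\<bar>) powr (s - 2))"
  have q: "1 < q" "(p - s) / s = q - 1" "p = q * s"
    using s p by (auto simp: q_def diff_divide_distrib)
  have "A \<ge> 0" "B \<ge> 0"
    by (auto simp: A_def B_def intro: sum_nonneg)
  have "c * R \<le> (\<Sum>i\<in>I. \<bar>u i + v i\<bar> powr s - \<bar>u i\<bar> powr s - s * (\<bar>u i\<bar> powr (s - 2) * u i * v i))"
    unfolding R_def sum_distrib_left by (intro sum_mono c)
  also have "\<dots> = B - A - s * S"
    by (simp add: A_def B_def S_def sum_subtractf sum_distrib_left)
  finally have "q * A powr (q - 1) * (c * R) \<le> q * A powr (q - 1) * (B - A - s * S)"
    using q by (intro mult_left_mono) auto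
  moreover have "A powr q + q * A powr (q - 1) * (B - A) \<le> B powr q"
  \<comment> \<open>The strict tangent inequality excludes these cases. At \<open>A = 0\<close> the
    slope \<open>0 powr (q - 1)\<close> is 0 and the claim is \<open>0 \<le> B powr q\<close>; at
    \<open>A = B\<close> equality holds.\<close>
  proof (cases "A = 0 \<or> A = B")
    case False
    then show ?thesis
      using powr_gt_tangent[of q B A] q \<open>A \<ge> 0\<close> \<open>B \<ge> 0\<close> by simp
  qed auto
  ultimately have "q * c * A powr (q - 1) * R
      \<le> B powr q - A powr q - q * s * A powr (q - 1) * S"
    by (simp add: algebra_simps)
  then show ?thesis
    unfolding q(2) S_def[symmetric] R_def[symmetric] q_def[symmetric] using q(3) by simp
qed

lemma abs_scaled_powr:
  assumes "0 < s" "0 < a i x"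
  shows "\<bar>scaled s a x \<xi> i\<bar> powr s = a i x * \<bar>\<xi> i\<bar> powr s"
  using assms by (simp add: scaled_def abs_mult powr_mult powr_powr)

lemma wnorm_powr_eq_scaled:
  assumes "0 < s" "\<And>i. i \<in> {1..n} \<Longrightarrow> 0 < a i x"
  shows "wnorm n s a x \<xi> powr r = (\<Sum>i=1..n. \<bar>scaled s a x \<xi> i\<bar> powr s) powr (r / s)"
proof -
  have "(\<Sum>i=1..n. a i x * \<bar>\<xi> i\<bar> powr s) = (\<Sum>i=1..n. \<bar>scaled s a x \<xi> i\<bar> powr s)"
    using assms by (intro sum.cong refl abs_scaled_powr[symmetric]) auto
  then show ?thesis
    by (simp add: wnorm_def powr_powr)
qed

lemma scaled_add: "scaled s a x (\<lambda>i. \<xi> i + \<eta> i) i = scaled s a x \<xi> i + scaled s a x \<eta> i"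
  by (simp add: scaled_def algebra_simps)

lemma scaled_cross_term:
  assumes "0 < s" "0 < a i x"
  shows "\<bar>scaled s a x \<xi> i\<bar> powr (s - 2) * scaled s a x \<xi> i * scaled s a x \<eta> i
    = a i x * \<bar>\<xi> i\<bar> powr (s - 2) * \<xi> i * \<eta> i"
proof -
  \<comment> \<open>These are the exponents of \<open>a i x\<close> contributed by the three scaled
    factors; together they restore exactly one power of the weight.\<close>
  have "(s - 2) / s + 1 / s + 1 / s = 1"
    using assms by (simp add: field_simps)
  then have "a i x powr ((s - 2) / s) * a i x powr (1 / s) * a i x powr (1 / s) = a i x"
    using assms by (simp flip: powr_add)
  then have "a i x powr ((s - 2) / s) * a i x powr (1 / s) * a i x powr (1 / s) * (\<bar>\<xi> i\<bar> powr (s - 2) * \<xi> i * \<eta> i)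
      = a i x * (\<bar>\<xi> i\<bar> powr (s - 2) * \<xi> i * \<eta> i)"
    by simp
  then show ?thesis
    using assms by (simp add: scaled_def abs_mult powr_mult powr_powr mult_ac)
qed

theorem lemma3p9:
  fixes s p :: real
  assumes "1 < s" and "s < p"
  shows "\<exists>c>0. \<forall>n\<ge>2. \<forall>\<Omega> a. is_domain n \<Omega> \<longrightarrow> weight_vector n \<Omega> a \<longrightarrow>
    (AE x\<in>\<Omega> in lebesgue_n n. \<forall>\<xi>\<in>Rn n. \<forall>\<eta>\<in>Rn n.
       wnorm n s a x (\<lambda>i. \<xi> i + \<eta> i) powr p - wnorm n s a x \<xi> powr p
         - p * wnorm n s a x \<xi> powr (p - s) * (\<Sum>i=1..n. a i x * \<bar>\<xi> i\<bar> powr (s - 2) * \<xi> i * \<eta> i)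
       \<ge> c * wnorm n s a x \<xi> powr (p - s)
         * (\<Sum>i=1..n. \<bar>scaled s a x \<eta> i\<bar>\<^sup>2 * (\<bar>scaled s a x \<eta> i\<bar> + \<bar>scaled s a x \<xi> i\<bar>) powr (s - 2)))"
proof -
  obtain c where c: "0 < c" "\<And>u v. c * (v\<^sup>2 * (\<bar>v\<bar> + \<bar>u\<bar>) powr (s - 2))
      \<le> \<bar>u + v\<bar> powr s - \<bar>u\<bar> powr s - s * (\<bar>u\<bar> powr (s - 2) * u * v)"
    using bregman_abs_powr[OF assms(1)] by blast
  have pointwise: "wnorm n s a x (\<lambda>i. \<xi> i + \<eta> i) powr p - wnorm n s a x \<xi> powr p
         - p * wnorm n s a x \<xi> powr (p - s) * (\<Sum>i=1..n. a i x * \<bar>\<xi> i\<bar> powr (s - 2) * \<xi> i * \<eta> i)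
       \<ge> p / s * c * wnorm n s a x \<xi> powr (p - s)
         * (\<Sum>i=1..n. \<bar>scaled s a x \<eta> i\<bar>\<^sup>2 * (\<bar>scaled s a x \<eta> i\<bar> + \<bar>scaled s a x \<xi> i\<bar>) powr (s - 2))"
    if pos: "\<And>i. i \<in> {1..n} \<Longrightarrow> 0 < a i x" for n a x \<xi> \<eta>
  proof -
    have "0 < s"
      using assms by simp
    then have norm: "wnorm n s a x \<zeta> powr r = (\<Sum>i=1..n. \<bar>scaled s a x \<zeta> i\<bar> powr s) powr (r / s)" for \<zeta> r
      using pos by (rule wnorm_powr_eq_scaled)
    have cross: "(\<Sum>i=1..n. a i x * \<bar>\<xi> i\<bar> powr (s - 2) * \<xi> i * \<eta> i)
        = (\<Sum>i=1..n. \<bar>scaled s a x \<xi> i\<bar> powr (s - 2) * scaled s a x \<xi> i * scaled s a x \<eta> i)"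
      using \<open>0 < s\<close> pos by (intro sum.cong refl scaled_cross_term[symmetric])
    show ?thesis
      using bregman_lnorm_powr[OF assms c(2), where I = "{1..n}" and u = "scaled s a x \<xi>"
          and v = "scaled s a x \<eta>"]
      unfolding norm cross scaled_add power2_abs by simp
  qed
  \<comment> \<open>The factor \<open>p / s\<close> is the slope factor of the outer power. The
    weights are positive at every point of \<Omega>, so the pointwise estimate holds throughout
    \<Omega>, hence almost everywhere.\<close>
  have "0 < p / s * c"
    using assms c(1) by simp
  moreover have "0 < a i x" if "weight_vector n \<Omega> a" "x \<in> \<Omega>" "i \<in> {1..n}" for n \<Omega> a x i
    using that by (auto simp: weight_vector_def)
  ultimately show ?thesis
    by (intro exI[of _ "p / s * c"] conjI allI impI AE_I2 ballI pointwise) auto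
qed

end
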